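(* For all $\mathsf{PTSC}\alpha$ terms $M,N$: if $M\to_{\mathsf{Bx}'}N$ then $\mathcal B(M)\to_\beta^*\mathcal B(N)$; and for all lists $l,l'$ and every variable $y$: if $l\to_{\mathsf{Bx}'}l'$ then $\mathcal B^y(l)\to_\beta^*\mathcal B^y(l')$. (That is, $\beta$-reduction simulates $\mathsf{Bx}'$-reduction through the translation $\mathcal B$.)
   Context: Fix a set $\mathcal S$ of sorts, a denumerable set of variables, and two denumerable sets of meta-variables: term meta-variables $\alpha$ and list meta-variables $\beta$, each with a fixed arity $n$. $\mathsf{PTSC}\alpha$ terms and lists: $M ::= \Pi x^{A}.B \mid \lambda x^{A}.M \mid s \mid x\,l \mid M\,l \mid \langle N/x\rangle_A M \mid \alpha(M_1,\dots,M_n)$, $l ::= [\,] \mid M\cdot l \mid l @ l' \mid \langle N/x\rangle_A l \mid \beta(M_1,\dots,M_n)$, where $\langle N/x\rangle_A(\cdot)$ is explicit substitution (binding $x$) and $\Pi$, $\lambda$ bind $x$; up to $\alpha$-conversion. Reduction rules: (B) $(\lambda x^A.M)\,(N\cdot l)\to(\langle N/x\rangle_A M)\,l$, and the system $\mathsf{x}'$: (B1) $M\,[\,]\to M$; (B2) $(x\,l)\,l'\to x\,(l@l')$; (B3) $(M\,l)\,l'\to M\,(l@l')$; (A1) $(M\cdot l')@l\to M\cdot(l'@l)$; (A2) $[\,]@l\to l$; (A3) $(l@l')@l''\to l@(l'@l'')$; (A4) $l@[\,]\to l$; (C1) $\langle P/y\rangle_G(\lambda x^A.M)\to\lambda x^{\langle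 P/y\rangle_G A}.\langle P/y\rangle_G M$; (C2) $\langle P/y\rangle_G(y\,l)\to P\,(\langle P/y\rangle_G l)$; (C3) $\langle P/y\rangle_G(x\,l)\to x\,(\langle P/y\rangle_G l)$ if $x\neq y$; (C4) $\langle P/y\rangle_G(M\,l)\to(\langle P/y\rangle_G M)\,(\langle P/y\rangle_G l)$; (C5) $\langle P/y\rangle_G(\Pi x^A.B)\to\Pi x^{\langle P/y\rangle_G A}.\langle P/y\rangle_G B$; (C6) $\langle P/y\rangle_G s\to s$; (C$\alpha$) $\langle P/y\rangle_G\alpha(M_1,\dots,M_n)\to\alpha(\langle P/y\rangle_G M_1,\dots,\langle P/y\rangle_G M_n)$; (D1) $\langle P/y\rangle_G[\,]\to[\,]$; (D2) $\langle P/y\rangle_G(M\cdot l)\to(\langle P/y\rangle_G M)\cdot(\langle P/y\rangle_G l)$; (D3) $\langle P/y\rangle_G(l@l')\to(\langle P/y\rangle_G l)@(\langle P/y\rangle_G l')$; (D$\beta$) $\langle P/y\rangle_G\beta(M_1,\dots,M_n)\to\beta(\langle P/y\rangle_G M_1,\dots,\langle P/y\rangle_G M_n)$. $\to_{\mathsf{Bx}'}$ is the contextual closure of all these rules (capture avoidance understood). PTS terms: $t,u,T ::= x\mid s\mid \Pi x^T.t\mid\lambda x^T.t\mid t\,u$; $\to_\beta$ is the contextual closure of $(\lambda x^v.t)\,u\to t\{x:=u\}$, with $t\{x:=u\}$ capture-avoiding substitution. For each term (resp. list) meta-variable $\alpha$ (resp. $\beta$) of arity $k$ a PTS variable $\alpha^k$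 (resp. $\beta^k$) is reserved. Translation $\mathcal B$ from $\mathsf{PTSC}\alpha$ to PTS terms: $\mathcal B(\Pi x^A.B)=\Pi x^{\mathcal B(A)}.\mathcal B(B)$, $\mathcal B(\lambda x^A.M)=\lambda x^{\mathcal B(A)}.\mathcal B(M)$, $\mathcal B(s)=s$, $\mathcal B(x\,l)=\mathcal B^z(l)\{z:=x\}$, $\mathcal B(M\,l)=\mathcal B^z(l)\{z:=\mathcal B(M)\}$ ($z$ fresh), $\mathcal B(\langle P/x\rangle_K M)=\mathcal B(M)\{x:=\mathcal B(P)\}$, $\mathcal B(\alpha(M_1,\dots,M_n))=\alpha^n\,\mathcal B(M_1)\cdots\mathcal B(M_n)$; and for a variable $y$: $\mathcal B^y([\,])=y$, $\mathcal B^y(M\cdot l)=\mathcal B^z(l)\{z:=y\,\mathcal B(M)\}$, $\mathcal B^y(l@l')=\mathcal B^z(l')\{z:=\mathcal B^y(l)\}$ ($z$ fresh), $\mathcal B^y(\langle P/x\rangle_K l)=\mathcal B^y(l)\{x:=\mathcal B(P)\}$, $\mathcal B^y(\beta(M_1,\dots,M_n))=\beta^n\,y\,\mathcal B(M_1)\cdots\mathcal B(M_n)$. *)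

theory Defs
  imports Main "HOL-Combinatorics.Transposition"
begin

text \<open>
  Expressions up to \<open>\<alpha>\<close>-conversion are represented with de Bruijn indices: an index \<open>i\<close> occurring
  under \<open>n\<close> binders is bound if \<open>i < n\<close> and otherwise is the free variable number \<open>i - n\<close>.
  The set of sorts is the type \<open>'s\<close>. Both denumerable sets of meta-variables are copies of \<open>nat\<close>;
  their arities are arbitrary functions \<open>arT\<close>, \<open>arL\<close>, enforced by \<open>wf_tm\<close> and \<open>wf_ls\<close>.
\<close>

section \<open>\<open>PTSC\<alpha>\<close>\<close>

text \<open>
  \<open>Pi A B\<close>, \<open>Lam A M\<close> bind index 0 in \<open>B\<close>, \<open>M\<close>; \<open>Sub N A M\<close> is \<open>\<langle>N/x\<rangle>\<^sub>A M\<close> and binds index 0 in \<open>M\<close>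
  only (likewise \<open>LSub\<close>). \<open>VApp x l\<close> and \<open>App M l\<close> are the two applications \<open>x l\<close> and \<open>M l\<close>.
\<close>

datatype 's tm =
    Pi "'s tm" "'s tm"
  | Lam "'s tm" "'s tm"
  | Sort 's
  | VApp nat "'s ls"
  | App "'s tm" "'s ls"
  | Sub "'s tm" "'s tm" "'s tm"
  | Meta nat "'s tm list"
and 's ls =
    LNil
  | LCons "'s tm" "'s ls"
  | LAppend "'s ls" "'s ls"
  | LSub "'s tm" "'s tm" "'s ls"
  | LMeta nat "'s tm list"

fun wf_tm :: "(nat \<Rightarrow> nat) \<Rightarrow> (nat \<Rightarrow> nat) \<Rightarrow> 's tm \<Rightarrow> bool"
and wf_ls :: "(nat \<Rightarrow> nat) \<Rightarrow> (nat \<Rightarrow> nat) \<Rightarrow> 's ls \<Rightarrow> bool" where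
  "wf_tm arT arL (Pi A B) \<longleftrightarrow> wf_tm arT arL A \<and> wf_tm arT arL B"
| "wf_tm arT arL (Lam A M) \<longleftrightarrow> wf_tm arT arL A \<and> wf_tm arT arL M"
| "wf_tm arT arL (Sort s) \<longleftrightarrow> True"
| "wf_tm arT arL (VApp x l) \<longleftrightarrow> wf_ls arT arL l"
| "wf_tm arT arL (App M l) \<longleftrightarrow> wf_tm arT arL M \<and> wf_ls arT arL l"
| "wf_tm arT arL (Sub N A M) \<longleftrightarrow> wf_tm arT arL N \<and> wf_tm arT arL A \<and> wf_tm arT arL M"
| "wf_tm arT arL (Meta a Ms) \<longleftrightarrow> length Ms = arT a \<and> (\<forall>M\<in>set Ms. wf_tm arT arL M)"
| "wf_ls arT arL LNil \<longleftrightarrow> True"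
| "wf_ls arT arL (LCons M l) \<longleftrightarrow> wf_tm arT arL M \<and> wf_ls arT arL l"
| "wf_ls arT arL (LAppend l l') \<longleftrightarrow> wf_ls arT arL l \<and> wf_ls arT arL l'"
| "wf_ls arT arL (LSub N A l) \<longleftrightarrow> wf_tm arT arL N \<and> wf_tm arT arL A \<and> wf_ls arT arL l"
| "wf_ls arT arL (LMeta b Ms) \<longleftrightarrow> length Ms = arL b \<and> (\<forall>M\<in>set Ms. wf_tm arT arL M)"

definition up_ren :: "(nat \<Rightarrow> nat) \<Rightarrow> nat \<Rightarrow> nat" where
  "up_ren f = case_nat 0 (\<lambda>n. Suc (f n))"

primrec ren_tm :: "(nat \<Rightarrow> nat) \<Rightarrow> 's tm \<Rightarrow> 's tm"
and ren_ls :: "(nat \<Rightarrow> nat) \<Rightarrow> 's ls \<Rightarrow> 's ls" where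
  "ren_tm f (Pi A B) = Pi (ren_tm f A) (ren_tm (up_ren f) B)"
| "ren_tm f (Lam A M) = Lam (ren_tm f A) (ren_tm (up_ren f) M)"
| "ren_tm f (Sort s) = Sort s"
| "ren_tm f (VApp x l) = VApp (f x) (ren_ls f l)"
| "ren_tm f (App M l) = App (ren_tm f M) (ren_ls f l)"
| "ren_tm f (Sub N A M) = Sub (ren_tm f N) (ren_tm f A) (ren_tm (up_ren f) M)"
| "ren_tm f (Meta a Ms) = Meta a (map (ren_tm f) Ms)"
| "ren_ls f LNil = LNil"
| "ren_ls f (LCons M l) = LCons (ren_tm f M) (ren_ls f l)"
| "ren_ls f (LAppend l l') = LAppend (ren_ls f l) (ren_ls f l')"
| "ren_ls f (LSub N A l) = LSub (ren_tm f N) (ren_tm f A) (ren_ls (up_ren f) l)"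
| "ren_ls f (LMeta b Ms) = LMeta b (map (ren_tm f) Ms)"

text \<open>
  In \<open>C1\<close> and \<open>C5\<close> the explicit substitution moves under a binder: \<open>P\<close> and \<open>G\<close> are weakened, and as
  the two binders are exchanged, indices 0 and 1 of the body are swapped.
  Of the two subcases \<open>C2\<close>, \<open>C3\<close>, index 0 is the substituted variable \<open>y\<close>, and \<open>Suc x\<close> is the
  variable that is called \<open>x\<close> outside of the scope of the substitution.
\<close>

inductive rule_B :: "'s tm \<Rightarrow> 's tm \<Rightarrow> bool" where
  B: "rule_B (App (Lam A M) (LCons N l)) (App (Sub N A M) l)"

inductive rule_x_tm :: "'s tm \<Rightarrow> 's tm \<Rightarrow> bool" where
  B1: "rule_x_tm (App M LNil) M"
| B2: "rule_x_tm (App (VApp x l) l') (VApp x (LAppend l l'))"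
| B3: "rule_x_tm (App (App M l) l') (App M (LAppend l l'))"
| C1: "rule_x_tm (Sub P G (Lam A M))
        (Lam (Sub P G A) (Sub (ren_tm Suc P) (ren_tm Suc G) (ren_tm (transpose 0 1) M)))"
| C2: "rule_x_tm (Sub P G (VApp 0 l)) (App P (LSub P G l))"
| C3: "rule_x_tm (Sub P G (VApp (Suc x) l)) (VApp x (LSub P G l))"
| C4: "rule_x_tm (Sub P G (App M l)) (App (Sub P G M) (LSub P G l))"
| C5: "rule_x_tm (Sub P G (Pi A B))
        (Pi (Sub P G A) (Sub (ren_tm Suc P) (ren_tm Suc G) (ren_tm (transpose 0 1) B)))"
| C6: "rule_x_tm (Sub P G (Sort s)) (Sort s)"
| Calpha: "rule_x_tm (Sub P G (Meta a Ms)) (Meta a (map (Sub P G) Ms))"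

inductive rule_x_ls :: "'s ls \<Rightarrow> 's ls \<Rightarrow> bool" where
  A1: "rule_x_ls (LAppend (LCons M l') l) (LCons M (LAppend l' l))"
| A2: "rule_x_ls (LAppend LNil l) l"
| A3: "rule_x_ls (LAppend (LAppend l l') l'') (LAppend l (LAppend l' l''))"
| A4: "rule_x_ls (LAppend l LNil) l"
| D1: "rule_x_ls (LSub P G LNil) LNil"
| D2: "rule_x_ls (LSub P G (LCons M l)) (LCons (Sub P G M) (LSub P G l))"
| D3: "rule_x_ls (LSub P G (LAppend l l')) (LAppend (LSub P G l) (LSub P G l'))"
| Dbeta: "rule_x_ls (LSub P G (LMeta b Ms)) (LMeta b (map (Sub P G) Ms))"

inductive cc_tm :: "('s tm \<Rightarrow> 's tm \<Rightarrow> bool) \<Rightarrow> ('s ls \<Rightarrow> 's ls \<Rightarrow> bool) \<Rightarrow> 's tm \<Rightarrow> 's tm \<Rightarrow> bool"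
and cc_ls :: "('s tm \<Rightarrow> 's tm \<Rightarrow> bool) \<Rightarrow> ('s ls \<Rightarrow> 's ls \<Rightarrow> bool) \<Rightarrow> 's ls \<Rightarrow> 's ls \<Rightarrow> bool"
for RT RL where
  root_tm: "RT M N \<Longrightarrow> cc_tm RT RL M N"
| Pi_ty: "cc_tm RT RL A A' \<Longrightarrow> cc_tm RT RL (Pi A B) (Pi A' B)"
| Pi_body: "cc_tm RT RL B B' \<Longrightarrow> cc_tm RT RL (Pi A B) (Pi A B')"
| Lam_ty: "cc_tm RT RL A A' \<Longrightarrow> cc_tm RT RL (Lam A M) (Lam A' M)"
| Lam_body: "cc_tm RT RL M M' \<Longrightarrow> cc_tm RT RL (Lam A M) (Lam A M')"
| VApp_ls: "cc_ls RT RL l l' \<Longrightarrow> cc_tm RT RL (VApp x l) (VApp x l')"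
| App_tm: "cc_tm RT RL M M' \<Longrightarrow> cc_tm RT RL (App M l) (App M' l)"
| App_ls: "cc_ls RT RL l l' \<Longrightarrow> cc_tm RT RL (App M l) (App M l')"
| Sub_arg: "cc_tm RT RL N N' \<Longrightarrow> cc_tm RT RL (Sub N A M) (Sub N' A M)"
| Sub_ty: "cc_tm RT RL A A' \<Longrightarrow> cc_tm RT RL (Sub N A M) (Sub N A' M)"
| Sub_body: "cc_tm RT RL M M' \<Longrightarrow> cc_tm RT RL (Sub N A M) (Sub N A M')"
| Meta_arg: "cc_tm RT RL M M' \<Longrightarrow> cc_tm RT RL (Meta a (Ms @ M # Ns)) (Meta a (Ms @ M' # Ns))"
| root_ls: "RL l l' \<Longrightarrow> cc_ls RT RL l l'"
| LCons_hd: "cc_tm RT RL M M' \<Longrightarrow> cc_ls RT RL (LCons M l) (LCons M' l)"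
| LCons_tl: "cc_ls RT RL l l' \<Longrightarrow> cc_ls RT RL (LCons M l) (LCons M l')"
| LAppend_left: "cc_ls RT RL l k \<Longrightarrow> cc_ls RT RL (LAppend l l') (LAppend k l')"
| LAppend_right: "cc_ls RT RL l' k \<Longrightarrow> cc_ls RT RL (LAppend l l') (LAppend l k)"
| LSub_arg: "cc_tm RT RL N N' \<Longrightarrow> cc_ls RT RL (LSub N A l) (LSub N' A l)"
| LSub_ty: "cc_tm RT RL A A' \<Longrightarrow> cc_ls RT RL (LSub N A l) (LSub N A' l)"
| LSub_body: "cc_ls RT RL l l' \<Longrightarrow> cc_ls RT RL (LSub N A l) (LSub N A l')"
| LMeta_arg: "cc_tm RT RL M M' \<Longrightarrow> cc_ls RT RL (LMeta b (Ms @ M # Ns)) (LMeta b (Ms @ M' # Ns))"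

definition red_Bx_tm :: "'s tm \<Rightarrow> 's tm \<Rightarrow> bool" where
  "red_Bx_tm = cc_tm (\<lambda>M N. rule_B M N \<or> rule_x_tm M N) rule_x_ls"

definition red_Bx_ls :: "'s ls \<Rightarrow> 's ls \<Rightarrow> bool" where
  "red_Bx_ls = cc_ls (\<lambda>M N. rule_B M N \<or> rule_x_tm M N) rule_x_ls"

section \<open>PTS terms\<close>

text \<open>
  The variables of PTS terms are the ordinary ones (de Bruijn indices) and, for each meta-variable, a
  reserved one. Only ordinary variables need to be bound: up to \<open>\<alpha>\<close>-conversion every bound variable
  can be chosen ordinary. Renamings and substitutions hence leave the reserved variables unchanged.
\<close>

datatype pvar = Ord nat | ResT nat | ResL nat

datatype 's pts =
    PVar pvar
  | PSort 's
  | PPi "'s pts" "'s pts"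
  | PLam "'s pts" "'s pts"
  | PApp "'s pts" "'s pts"

primrec ren_pvar :: "(nat \<Rightarrow> nat) \<Rightarrow> pvar \<Rightarrow> pvar" where
  "ren_pvar f (Ord n) = Ord (f n)"
| "ren_pvar f (ResT a) = ResT a"
| "ren_pvar f (ResL b) = ResL b"

primrec ren_pts :: "(nat \<Rightarrow> nat) \<Rightarrow> 's pts \<Rightarrow> 's pts" where
  "ren_pts f (PVar v) = PVar (ren_pvar f v)"
| "ren_pts f (PSort s) = PSort s"
| "ren_pts f (PPi T t) = PPi (ren_pts f T) (ren_pts (up_ren f) t)"
| "ren_pts f (PLam T t) = PLam (ren_pts f T) (ren_pts (up_ren f) t)"
| "ren_pts f (PApp t u) = PApp (ren_pts f t) (ren_pts f u)"

definition up_sub :: "(nat \<Rightarrow> 's pts) \<Rightarrow> nat \<Rightarrow> 's pts" where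
  "up_sub \<sigma> = case_nat (PVar (Ord 0)) (\<lambda>n. ren_pts Suc (\<sigma> n))"

primrec sub_pvar :: "(nat \<Rightarrow> 's pts) \<Rightarrow> pvar \<Rightarrow> 's pts" where
  "sub_pvar \<sigma> (Ord n) = \<sigma> n"
| "sub_pvar \<sigma> (ResT a) = PVar (ResT a)"
| "sub_pvar \<sigma> (ResL b) = PVar (ResL b)"

text \<open>Simultaneous capture-avoiding substitution of all ordinary variables.\<close>

primrec sub_pts :: "(nat \<Rightarrow> 's pts) \<Rightarrow> 's pts \<Rightarrow> 's pts" where
  "sub_pts \<sigma> (PVar v) = sub_pvar \<sigma> v"
| "sub_pts \<sigma> (PSort s) = PSort s"
| "sub_pts \<sigma> (PPi T t) = PPi (sub_pts \<sigma> T) (sub_pts (up_sub \<sigma>) t)"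
| "sub_pts \<sigma> (PLam T t) = PLam (sub_pts \<sigma> T) (sub_pts (up_sub \<sigma>) t)"
| "sub_pts \<sigma> (PApp t u) = PApp (sub_pts \<sigma> t) (sub_pts \<sigma> u)"

text \<open>\<open>t{x:=u}\<close>, where \<open>x\<close> is index 0 of \<open>t\<close>; the remaining indices are decremented.\<close>

definition subst0 :: "'s pts \<Rightarrow> 's pts \<Rightarrow> 's pts" where
  "subst0 t u = sub_pts (case_nat u (\<lambda>n. PVar (Ord n))) t"

inductive red_beta :: "'s pts \<Rightarrow> 's pts \<Rightarrow> bool" where
  beta: "red_beta (PApp (PLam v t) u) (subst0 t u)"
| PPi_ty: "red_beta T T' \<Longrightarrow> red_beta (PPi T t) (PPi T' t)"
| PPi_body: "red_beta t t' \<Longrightarrow> red_beta (PPi T t) (PPi T t')"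
| PLam_ty: "red_beta T T' \<Longrightarrow> red_beta (PLam T t) (PLam T' t)"
| PLam_body: "red_beta t t' \<Longrightarrow> red_beta (PLam T t) (PLam T t')"
| PApp_fun: "red_beta t t' \<Longrightarrow> red_beta (PApp t u) (PApp t' u)"
| PApp_arg: "red_beta u u' \<Longrightarrow> red_beta (PApp t u) (PApp t u')"

section \<open>Translation\<close>

lemma size_ren [simp]:
  fixes M :: "'s tm" and l :: "'s ls"
  shows "size (ren_tm f M) = size M" and "size (ren_ls f l) = size l"
proof (induction M and l arbitrary: f and f)
  case (Meta a Ms)
  then show ?case by (simp add: size_list_conv_sum_list comp_def cong: map_cong)
next
  case (LMeta b Ms)
  then show ?case by (simp add: size_list_conv_sum_list comp_def cong: map_cong)
qed simp_all

text \<open>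
  \<open>tr M\<close> is \<open>\<B>(M)\<close> and \<open>tr_ls y l\<close> is \<open>\<B>\<^sup>y(l)\<close>. For a fresh \<open>z\<close>, \<open>\<B>\<^sup>z(l)\<close> is \<open>tr_ls 0 (ren_ls Suc l)\<close>:
  after weakening \<open>l\<close>, index 0 does not occur in it. In the clause for \<open>LSub\<close>, \<open>y\<close> becomes \<open>Suc y\<close>
  in the scope of the substitution.
\<close>

function (sequential) tr :: "'s tm \<Rightarrow> 's pts"
and tr_ls :: "nat \<Rightarrow> 's ls \<Rightarrow> 's pts" where
  "tr (Pi A B) = PPi (tr A) (tr B)"
| "tr (Lam A M) = PLam (tr A) (tr M)"
| "tr (Sort s) = PSort s"
| "tr (VApp x l) = subst0 (tr_ls 0 (ren_ls Suc l)) (PVar (Ord x))"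
| "tr (App M l) = subst0 (tr_ls 0 (ren_ls Suc l)) (tr M)"
| "tr (Sub P K M) = subst0 (tr M) (tr P)"
| "tr (Meta a Ms) = foldl PApp (PVar (ResT a)) (map tr Ms)"
| "tr_ls y LNil = PVar (Ord y)"
| "tr_ls y (LCons M l) = subst0 (tr_ls 0 (ren_ls Suc l)) (PApp (PVar (Ord y)) (tr M))"
| "tr_ls y (LAppend l l') = subst0 (tr_ls 0 (ren_ls Suc l')) (tr_ls y l)"
| "tr_ls y (LSub P K l) = subst0 (tr_ls (Suc y) l) (tr P)"
| "tr_ls y (LMeta b Ms) = foldl PApp (PApp (PVar (ResL b)) (PVar (Ord y))) (map tr Ms)"
  by pat_completeness auto
termination
  by (relation "measure (case_sum size (\<lambda>(y, l). size l))")
    (auto simp: less_Suc_eq_le size_list_estimation' trans_le_add1)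

end

theory Submission
  imports Defs
begin

text \<open>
  For a fresh \<open>z\<close> the expression \<open>\<B>\<^sup>z(l){z:=u}\<close> can be computed directly by structural recursion on \<open>l\<close>
  with the head \<open>u\<close> as a parameter (\<open>fill l u\<close> below); then \<open>\<B>(M l)\<close> is \<open>fill l (\<B>(M))\<close> and
  \<open>\<B>\<^sup>y(l)\<close> is \<open>fill l y\<close>. In this form every rule of \<open>x'\<close> becomes an equality of PTS terms: (C2), (C4),
  (D2) and (D3) hold because a substitution instance of \<open>fill l u\<close> depends on \<open>u\<close> only through the same
  instance of \<open>u\<close>, and (C1), (C5) because exchanging two indices compensates for moving under a binder.
  Rule (B) becomes one \<open>\<beta>\<close>-step in the head. Contextual closure is respected since \<open>\<beta>\<close>-reduction is
  closed under substitution, both in the substituted term and in the term substituted into.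
\<close>

section \<open>Renaming and substitution in PTS terms\<close>

lemma up_ren_simps [simp]: "up_ren f 0 = 0" "up_ren f (Suc n) = Suc (f n)"
  by (simp_all add: up_ren_def)

lemma up_sub_simps [simp]:
  "up_sub \<sigma> 0 = PVar (Ord 0)" "up_sub \<sigma> (Suc n) = ren_pts Suc (\<sigma> n)"
  by (simp_all add: up_sub_def)

lemma up_ren_comp: "up_ren f \<circ> up_ren g = up_ren (f \<circ> g)"
  by (rule ext, rename_tac n, case_tac n) auto

lemma ren_pvar_comp: "ren_pvar f (ren_pvar g v) = ren_pvar (f \<circ> g) v"
  by (cases v) auto

lemma ren_ren_pts: "ren_pts f (ren_pts g t) = ren_pts (f \<circ> g) t"
  by (induction t arbitrary: f g) (auto simp: ren_pvar_comp up_ren_comp)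

lemma up_sub_up_ren: "up_sub \<sigma> \<circ> up_ren f = up_sub (\<sigma> \<circ> f)"
  by (rule ext, rename_tac n, case_tac n) auto

lemma sub_pvar_ren_pvar: "sub_pvar \<sigma> (ren_pvar f v) = sub_pvar (\<sigma> \<circ> f) v"
  by (cases v) auto

lemma sub_ren_pts: "sub_pts \<sigma> (ren_pts f t) = sub_pts (\<sigma> \<circ> f) t"
  by (induction t arbitrary: \<sigma> f) (auto simp: sub_pvar_ren_pvar up_sub_up_ren)

lemma up_sub_ren: "ren_pts (up_ren f) \<circ> up_sub \<sigma> = up_sub (ren_pts f \<circ> \<sigma>)"
  by (rule ext, rename_tac n, case_tac n) (auto simp: ren_ren_pts comp_def)

lemma ren_sub_pvar: "ren_pts f (sub_pvar \<sigma> v) = sub_pvar (ren_pts f \<circ> \<sigma>) v"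
  by (cases v) auto

lemma ren_sub_pts: "ren_pts f (sub_pts \<sigma> t) = sub_pts (ren_pts f \<circ> \<sigma>) t"
  by (induction t arbitrary: \<sigma> f) (auto simp: ren_sub_pvar up_sub_ren)

lemma sub_up_ren_Suc: "sub_pts (up_sub \<sigma>) (ren_pts Suc t) = ren_pts Suc (sub_pts \<sigma> t)"
  by (simp add: sub_ren_pts ren_sub_pts comp_def)

lemma up_sub_comp: "sub_pts (up_sub \<sigma>) \<circ> up_sub \<tau> = up_sub (sub_pts \<sigma> \<circ> \<tau>)"
  by (rule ext, rename_tac n, case_tac n) (auto simp: sub_up_ren_Suc)

lemma sub_sub_pvar: "sub_pts \<sigma> (sub_pvar \<tau> v) = sub_pvar (sub_pts \<sigma> \<circ> \<tau>) v"
  by (cases v) auto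

lemma sub_sub_pts: "sub_pts \<sigma> (sub_pts \<tau> t) = sub_pts (sub_pts \<sigma> \<circ> \<tau>) t"
  by (induction t arbitrary: \<sigma> \<tau>) (auto simp: sub_sub_pvar up_sub_comp)

lemma up_sub_id: "up_sub (\<lambda>n. PVar (Ord n)) = (\<lambda>n. PVar (Ord n))"
  by (rule ext, rename_tac n, case_tac n) auto

lemma sub_pvar_id: "sub_pvar (\<lambda>n. PVar (Ord n)) v = PVar v"
  by (cases v) auto

lemma sub_pts_id: "sub_pts (\<lambda>n. PVar (Ord n)) t = t"
  by (induction t) (auto simp: up_sub_id sub_pvar_id)

abbreviation inst0 :: "'s pts \<Rightarrow> nat \<Rightarrow> 's pts" where
  "inst0 u \<equiv> case_nat u (\<lambda>n. PVar (Ord n))"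

lemma sub_inst0_ren_Suc [simp]: "sub_pts (inst0 u) (ren_pts Suc t) = t"
  by (simp add: sub_ren_pts comp_def sub_pts_id)

text \<open>This is the substitution lemma in de Bruijn form. Both composite maps give
  \<open>sub_pts \<sigma> u\<close> at index 0; at a successor the right one weakens
  \<open>\<sigma> n\<close> and then instantiates it, which cancels.\<close>

lemma sub_subst0: "sub_pts \<sigma> (subst0 t u) = subst0 (sub_pts (up_sub \<sigma>) t) (sub_pts \<sigma> u)"
proof -
  have "sub_pts \<sigma> \<circ> inst0 u = sub_pts (inst0 (sub_pts \<sigma> u)) \<circ> up_sub \<sigma>"
    by (rule ext, rename_tac n, case_tac n) auto
  then show ?thesis by (simp add: subst0_def sub_sub_pts)
qed

lemma ren_subst0: "ren_pts f (subst0 t u) = subst0 (ren_pts (up_ren f) t) (ren_pts f u)"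
proof -
  have "ren_pts f \<circ> inst0 u = inst0 (ren_pts f u) \<circ> up_ren f"
    by (rule ext, rename_tac n, case_tac n) auto
  then show ?thesis by (simp add: subst0_def sub_ren_pts ren_sub_pts)
qed

text \<open>Both maps fix index 0, send index 1 to the weakened \<open>u\<close> and lower every
  larger index by one. So the swap made in (C1) and (C5) amounts to substituting under the
  binder.\<close>

lemma subst0_under_binder:
  "subst0 (ren_pts (transpose 0 1) t) (ren_pts Suc u) = sub_pts (up_sub (inst0 u)) t"
proof -
  have "inst0 (ren_pts Suc u) \<circ> transpose 0 1 = up_sub (inst0 u)"
  proof
    fix n show "(inst0 (ren_pts Suc u) \<circ> transpose 0 1) n = up_sub (inst0 u) n"
      by (cases n; cases "n - 1") (auto simp: transpose_def)
  qed
  then show ?thesis by (simp add: subst0_def sub_ren_pts)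
qed

section \<open>Closure properties of \<open>\<beta>\<close>-reduction\<close>

lemma reds_PPi:
  assumes "red_beta\<^sup>*\<^sup>* T T'" "red_beta\<^sup>*\<^sup>* t t'"
  shows "red_beta\<^sup>*\<^sup>* (PPi T t) (PPi T' t')"
proof -
  have "red_beta\<^sup>*\<^sup>* (PPi T t) (PPi T' t)"
    using assms(1) by induction (auto intro: PPi_ty rtranclp.rtrancl_into_rtrancl)
  moreover have "red_beta\<^sup>*\<^sup>* (PPi T' t) (PPi T' t')"
    using assms(2) by induction (auto intro: PPi_body rtranclp.rtrancl_into_rtrancl)
  ultimately show ?thesis by simp
qed

lemma reds_PLam:
  assumes "red_beta\<^sup>*\<^sup>* T T'" "red_beta\<^sup>*\<^sup>* t t'"
  shows "red_beta\<^sup>*\<^sup>* (PLam T t) (PLam T' t')"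
proof -
  have "red_beta\<^sup>*\<^sup>* (PLam T t) (PLam T' t)"
    using assms(1) by induction (auto intro: PLam_ty rtranclp.rtrancl_into_rtrancl)
  moreover have "red_beta\<^sup>*\<^sup>* (PLam T' t) (PLam T' t')"
    using assms(2) by induction (auto intro: PLam_body rtranclp.rtrancl_into_rtrancl)
  ultimately show ?thesis by simp
qed

lemma reds_PApp:
  assumes "red_beta\<^sup>*\<^sup>* t t'" "red_beta\<^sup>*\<^sup>* u u'"
  shows "red_beta\<^sup>*\<^sup>* (PApp t u) (PApp t' u')"
proof -
  have "red_beta\<^sup>*\<^sup>* (PApp t u) (PApp t' u)"
    using assms(1) by induction (auto intro: PApp_fun rtranclp.rtrancl_into_rtrancl)
  moreover have "red_beta\<^sup>*\<^sup>* (PApp t' u) (PApp t' u')"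
    using assms(2) by induction (auto intro: PApp_arg rtranclp.rtrancl_into_rtrancl)
  ultimately show ?thesis by simp
qed

lemma reds_foldl_PApp:
  "red_beta\<^sup>*\<^sup>* t t' \<Longrightarrow> red_beta\<^sup>*\<^sup>* (foldl PApp t us) (foldl PApp t' us)"
  by (induction us arbitrary: t t') (auto intro: reds_PApp)

lemma red_sub: "red_beta t t' \<Longrightarrow> red_beta (sub_pts \<sigma> t) (sub_pts \<sigma> t')"
proof (induction arbitrary: \<sigma> rule: red_beta.induct)
  case (beta v t u)
  show ?case by (simp add: sub_subst0 red_beta.beta)
qed (auto intro: red_beta.intros)

lemma reds_sub: "red_beta\<^sup>*\<^sup>* t t' \<Longrightarrow> red_beta\<^sup>*\<^sup>* (sub_pts \<sigma> t) (sub_pts \<sigma> t')"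
  by (induction rule: rtranclp_induct) (auto intro: red_sub rtranclp.rtrancl_into_rtrancl)

lemma ren_eq_sub_pts: "ren_pts f t = sub_pts (\<lambda>n. PVar (Ord (f n))) t"
  using ren_sub_pts[of f "\<lambda>n. PVar (Ord n)" t] by (simp add: sub_pts_id comp_def)

lemma reds_ren: "red_beta\<^sup>*\<^sup>* t t' \<Longrightarrow> red_beta\<^sup>*\<^sup>* (ren_pts f t) (ren_pts f t')"
  unfolding ren_eq_sub_pts by (rule reds_sub)

lemma reds_up_sub:
  assumes "\<And>n. red_beta\<^sup>*\<^sup>* (\<sigma> n) (\<tau> n)"
  shows "red_beta\<^sup>*\<^sup>* (up_sub \<sigma> n) (up_sub \<tau> n)"
  by (cases n) (auto intro: reds_ren assms)

text \<open>Even one step in a substituted term may cost any number of steps, since its variable may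
  occur in \<open>t\<close> repeatedly or not at all.\<close>

lemma reds_sub_pointwise:
  "(\<And>n. red_beta\<^sup>*\<^sup>* (\<sigma> n) (\<tau> n)) \<Longrightarrow> red_beta\<^sup>*\<^sup>* (sub_pts \<sigma> t) (sub_pts \<tau> t)"
proof (induction t arbitrary: \<sigma> \<tau>)
  case (PVar v)
  then show ?case by (cases v) auto
qed (simp_all add: reds_PPi reds_PLam reds_PApp reds_up_sub)

lemma reds_subst0:
  assumes "red_beta\<^sup>*\<^sup>* t t'" "red_beta\<^sup>*\<^sup>* u u'"
  shows "red_beta\<^sup>*\<^sup>* (subst0 t u) (subst0 t' u')"
proof -
  have "red_beta\<^sup>*\<^sup>* (subst0 t u) (subst0 t' u)"
    unfolding subst0_def by (rule reds_sub[OF assms(1)])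
  moreover have "red_beta\<^sup>*\<^sup>* (subst0 t' u) (subst0 t' u')"
    unfolding subst0_def by (rule reds_sub_pointwise) (auto split: nat.split simp: assms(2))
  ultimately show ?thesis by simp
qed

section \<open>A structurally recursive form of the translation\<close>

text \<open>The head \<open>u\<close> lies outside the scope of the explicit substitution in
  \<open>LSub\<close>; weakening it keeps its index 0 from being captured.\<close>

primrec den :: "'s tm \<Rightarrow> 's pts"
and fill :: "'s ls \<Rightarrow> 's pts \<Rightarrow> 's pts" where
  "den (Pi A B) = PPi (den A) (den B)"
| "den (Lam A M) = PLam (den A) (den M)"
| "den (Sort s) = PSort s"
| "den (VApp x l) = fill l (PVar (Ord x))"
| "den (App M l) = fill l (den M)"
| "den (Sub P K M) = subst0 (den M) (den P)"
| "den (Meta a Ms) = foldl PApp (PVar (ResT a)) (map den Ms)"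
| "fill LNil u = u"
| "fill (LCons M l) u = fill l (PApp u (den M))"
| "fill (LAppend l l') u = fill l' (fill l u)"
| "fill (LSub P K l) u = subst0 (fill l (ren_pts Suc u)) (den P)"
| "fill (LMeta b Ms) u = foldl PApp (PApp (PVar (ResL b)) u) (map den Ms)"

lemma ren_foldl_PApp:
  "ren_pts f (foldl PApp t us) = foldl PApp (ren_pts f t) (map (ren_pts f) us)"
  by (induction us arbitrary: t) auto

lemma sub_foldl_PApp:
  "sub_pts \<sigma> (foldl PApp t us) = foldl PApp (sub_pts \<sigma> t) (map (sub_pts \<sigma>) us)"
  by (induction us arbitrary: t) auto

lemma den_ren: fixes M :: "'s tm" and l :: "'s ls"
  shows "den (ren_tm f M) = ren_pts f (den M)"
    and "fill (ren_ls f l) (ren_pts f u) = ren_pts f (fill l u)"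
proof (induction M and l arbitrary: f and f u)
  case (VApp x l)
  \<comment> \<open>The new head \<open>PVar (Ord (f x))\<close> has to be seen as a renamed term
    for the hypothesis on \<open>l\<close> to apply.\<close>
  show ?case using VApp.IH[of f "PVar (Ord x)"] by simp
next
  case (LCons M l)
  show ?case using LCons.IH(2)[of f "PApp u (den M)"] by (simp add: LCons.IH(1))
next
  case (LSub P K l)
  have "ren_pts Suc (ren_pts f u) = ren_pts (up_ren f) (ren_pts Suc u)"
    by (simp add: ren_ren_pts comp_def)
  then show ?case by (simp add: LSub.IH ren_subst0)
qed (auto simp: ren_subst0 ren_foldl_PApp comp_def cong: map_cong)

text \<open>Since \<open>\<sigma>\<close> undoes \<open>f\<close>, it cancels the renaming of the
  list and acts on the head alone. The case \<open>f = Suc\<close> eliminates the fresh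
  \<open>z\<close>; other \<open>f\<close> arise under the binder of \<open>LSub\<close>.\<close>

lemma sub_fill_ren:
  assumes "\<And>n. \<sigma> (f n) = PVar (Ord n)"
  shows "sub_pts \<sigma> (fill (ren_ls f l) u) = fill l (sub_pts \<sigma> u)"
proof -
  have den: "sub_pts \<sigma> (den (ren_tm f M)) = den M"
    if "\<And>n. \<sigma> (f n) = PVar (Ord n)" for \<sigma> f and M :: "'a tm"
    using that by (simp add: den_ren sub_ren_pts comp_def sub_pts_id)
  show ?thesis
    using assms
  proof (induction l arbitrary: \<sigma> f u rule: ls.induct[where ?P1.0 = "\<lambda>_. True"])
    case (LSub P K l)
    have "up_sub \<sigma> (up_ren f n) = PVar (Ord n)" for n
      by (cases n) (auto simp: LSub.prems)
    from LSub.IH[of "up_sub \<sigma>" "up_ren f", OF this] show ?case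
      by (simp add: sub_subst0 den LSub.prems sub_up_ren_Suc)
  qed (auto simp: den sub_foldl_PApp comp_def)
qed

lemma subst0_fill_ren_Suc: "subst0 (fill (ren_ls Suc l) (PVar (Ord 0))) u = fill l u"
  by (simp add: subst0_def sub_fill_ren)

lemma tr_eq_den: fixes M :: "'s tm" and l :: "'s ls"
  shows "tr M = den M" and "tr_ls y l = fill l (PVar (Ord y))"
  by (induction M and y l rule: tr_tr_ls.induct)
    (simp_all add: subst0_fill_ren_Suc cong: map_cong)

text \<open>Every operation that \<open>fill\<close> applies to the head commutes with substitution.
  An arbitrary \<open>\<sigma>\<close> is required because \<open>LSub\<close> passes to
  \<open>up_sub \<sigma>\<close>.\<close>

lemma sub_fill_cong:
  "sub_pts \<sigma> u = sub_pts \<sigma> u' \<Longrightarrow> sub_pts \<sigma> (fill l u) = sub_pts \<sigma> (fill l u')"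
proof (induction l arbitrary: \<sigma> u u' rule: ls.induct[where ?P1.0 = "\<lambda>_. True"])
  case (LCons M l)
  show ?case using LCons.IH[of \<sigma> "PApp u (den M)" "PApp u' (den M)"] LCons.prems by simp
next
  case (LAppend l l')
  show ?case
    using LAppend.IH(2)[OF LAppend.IH(1)[OF LAppend.prems]] by simp
next
  case (LSub P K l)
  have "sub_pts (up_sub \<sigma>) (ren_pts Suc u) = sub_pts (up_sub \<sigma>) (ren_pts Suc u')"
    by (simp add: sub_up_ren_Suc LSub.prems)
  from LSub.IH[OF this] show ?case by (simp add: sub_subst0)
qed (auto simp: sub_foldl_PApp)

text \<open>Instantiation cancels weakening, so both heads have the instance
  \<open>subst0 u p\<close>. The right side has the form of the \<open>LSub\<close> clause with that
  head, as (C2) to (C4), (D2) and (D3) require.\<close>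

lemma subst0_fill: "subst0 (fill l u) p = subst0 (fill l (ren_pts Suc (subst0 u p))) p"
  unfolding subst0_def by (rule sub_fill_cong) simp

lemma subst0_foldl_PApp:
  "subst0 (foldl PApp t us) p = foldl PApp (subst0 t p) (map (\<lambda>u. subst0 u p) us)"
  by (simp add: subst0_def sub_foldl_PApp cong: map_cong)

section \<open>Simulation\<close>

lemma reds_fill: "red_beta\<^sup>*\<^sup>* u u' \<Longrightarrow> red_beta\<^sup>*\<^sup>* (fill l u) (fill l u')"
  by (induction l arbitrary: u u' rule: ls.induct[where ?P1.0 = "\<lambda>_. True"])
    (simp_all add: reds_PApp reds_subst0 reds_ren reds_foldl_PApp)

lemma den_rule_B: "rule_B M N \<Longrightarrow> red_beta\<^sup>*\<^sup>* (den M) (den N)"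
  by (cases rule: rule_B.cases) (auto intro!: reds_fill red_beta.beta)

lemma den_rule_x_tm: "rule_x_tm M N \<Longrightarrow> den M = den N"
proof (induction rule: rule_x_tm.induct)
  case (C1 P G A M)
  then show ?case by (simp only: den.simps den_ren subst0_under_binder) (simp add: subst0_def)
next
  case (C2 P G l)
  \<comment> \<open>The head is the substituted variable itself, so its instance is
    \<open>den P\<close>.\<close>
  then show ?case using subst0_fill[of l "PVar (Ord 0)" "den P"] by (simp add: subst0_def)
next
  case (C3 P G x l)
  then show ?case using subst0_fill[of l "PVar (Ord (Suc x))" "den P"] by (simp add: subst0_def)
next
  case (C4 P G M l)
  then show ?case using subst0_fill[of l "den M" "den P"] by simp
next
  case (C5 P G A B)
  then show ?case by (simp only: den.simps den_ren subst0_under_binder) (simp add: subst0_def)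
next
  case (Calpha P G a Ms)
  then show ?case by (simp add: subst0_foldl_PApp comp_def) (simp add: subst0_def)
qed (auto simp: subst0_def)

lemma fill_rule_x_ls: "rule_x_ls l l' \<Longrightarrow> fill l u = fill l' u"
proof (induction rule: rule_x_ls.induct)
  case (D2 P G M l)
  then show ?case
    using subst0_fill[of l "PApp (ren_pts Suc u) (den M)" "den P"] by (simp add: subst0_def)
next
  case (D3 P G l l')
  then show ?case using subst0_fill[of l' "fill l (ren_pts Suc u)" "den P"] by simp
next
  case (Dbeta P G b Ms)
  then show ?case by (simp add: subst0_foldl_PApp comp_def) (simp add: subst0_def)
qed (auto simp: subst0_def)

text \<open>The list part must hold for every head \<open>u\<close>, as the contexts supply compound
  heads. Steps in the type annotation of \<open>Sub\<close> or \<open>LSub\<close> are erased and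
  give zero \<beta>-steps.\<close>

lemma den_red_Bx:
  fixes M N :: "'s tm" and l l' :: "'s ls"
  shows "cc_tm (\<lambda>M N. rule_B M N \<or> rule_x_tm M N) rule_x_ls M N \<Longrightarrow> red_beta\<^sup>*\<^sup>* (den M) (den N)"
    and "cc_ls (\<lambda>M N. rule_B M N \<or> rule_x_tm M N) rule_x_ls l l'
      \<Longrightarrow> red_beta\<^sup>*\<^sup>* (fill l u) (fill l' u)"
proof (induction M N and l l' arbitrary: and u rule: cc_tm_cc_ls.inducts)
  case (root_tm M N)
  then show ?case by (auto dest: den_rule_B den_rule_x_tm)
next
  case (root_ls l l')
  then show ?case by (simp add: fill_rule_x_ls)
next
  case (LAppend_left l k l')
  then show ?case by (simp add: reds_fill)
qed (auto intro: reds_PPi reds_PLam reds_PApp reds_subst0 reds_fill reds_foldl_PApp)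

theorem theorem2p2:
  fixes arT arL :: "nat \<Rightarrow> nat"
  shows "(\<forall>M N :: 's tm. wf_tm arT arL M \<longrightarrow> wf_tm arT arL N \<longrightarrow>
            red_Bx_tm M N \<longrightarrow> red_beta\<^sup>*\<^sup>* (tr M) (tr N))
       \<and> (\<forall>(l :: 's ls) l' y. wf_ls arT arL l \<longrightarrow> wf_ls arT arL l' \<longrightarrow>
            red_Bx_ls l l' \<longrightarrow> red_beta\<^sup>*\<^sup>* (tr_ls y l) (tr_ls y l'))"
  unfolding red_Bx_tm_def red_Bx_ls_def tr_eq_den
  by (blast intro: den_red_Bx)

end
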